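(* Let $G$ and $G'$ be two connected graphs. The lexicographical product $G[G']$ is word-representable if and only if $G$ is word-representable and $G'$ is a comparability graph. Moreover, if $\mathcal{R}(G)=k$ and $\mathcal{R}^p(G')=k'$, then $\mathcal{R}(G[G'])=\max\{k,k'\}$.
   Context: Graphs are simple (no loops or parallel edges) and undirected. Lexicographical product. For $G=(V,E)$ and $G'=(V',E')$, the lexicographical product $G[G']$ is the graph with vertex set $V\times V'$ in which $(a,a')$ and $(b,b')$ are adjacent if and only if $ab\in E$, or $a=b$ and $a'b'\in E'$. Words. A word over a finite set of letters is a finite sequence of those letters. For a word $w$ over $V$ and $B\subseteq V$, $w_B$ is the word obtained from $w$ by deleting all occurrences of letters not in $B$. Two letters $a,b$ alternate in $w$ if $w_{\{a,b\}}$ is of the form $ababa\cdots$ or $babab\cdots$ (of even or odd length). A word $w$ over $V$ represents $G=(V,E)$ if any two vertices are adjacent in $G$ if and only if they alternate in $w$. $G$ is word-representable if some word over $V$ represents it. $G$ is $k$-word-representable if it is represented by a word in which every vertex appears exactly $k$ times; it is known that a graph is word-representable if and only if it is $k$-word-representable for some $k$. The representation number $\mathcal{R}(G)$ of a word-representable graph $G$ is the smallest such $k$. Comparability graphs. $G$ is a comparability graph if its edges can be oriented transitively (whenever $a\to b$ and $b\to c$, also $a\to c$). $G$ is permutationally $k$-representable if it is represented by a word $p_1p_2\cdots p_k$ with each $p_i$ a permutation of the vertices of $G$. It is known that a graph is a comparability graph if and only if it is permutationally $k$-representable for some $k$; the permutation-representation number $\mathcal{R}^p(G)$ is the smallest such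 $k$.
   Formalization: G is additionally required to have at least two vertices: for one-vertex G the product G[G'] is isomorphic to G', and the claim fails, e.g. for G' the 5-cycle, which is word-representable but not a comparability graph. *)

theory Defs
  imports "Graph_Theory.Graph_Theory" "HOL-Combinatorics.Multiset_Permutations"
begin

text \<open>
  A simple undirected graph is a \<open>pair_graph\<close>: a finite, loop-free and symmetric set of
  arcs over a finite vertex set, so that \<open>a\<close> and \<open>b\<close> are adjacent iff \<open>(a, b) \<in> parcs G\<close>.
\<close>

definition lex_product ::
    "'a pair_pre_digraph \<Rightarrow> 'b pair_pre_digraph \<Rightarrow> ('a \<times> 'b) pair_pre_digraph" where
  "lex_product G G' = \<lparr>
     pverts = pverts G \<times> pverts G',
     parcs = {((a, a'), (b, b')) | a a' b b'.
       (a, a') \<in> pverts G \<times> pverts G' \<and> (b, b') \<in> pverts G \<times> pverts G' \<and>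
       ((a, b) \<in> parcs G \<or> a = b \<and> (a', b') \<in> parcs G')} \<rparr>"

lemma pair_graph_lex_product:
  assumes "pair_graph G" "pair_graph G'"
  shows "pair_graph (lex_product G G')"
proof -
  interpret G: pair_graph G by fact
  interpret G': pair_graph G' by fact
  have "finite (parcs (lex_product G G'))"
    by (rule finite_subset[of _ "(pverts G \<times> pverts G') \<times> (pverts G \<times> pverts G')"])
      (auto simp: lex_product_def G.pair_finite_verts G'.pair_finite_verts)
  then show ?thesis
    by unfold_locales
      (auto simp: lex_product_def symmetric_def sym_def G.pair_finite_verts G'.pair_finite_verts
        intro: G.arcs_symmetric G'.arcs_symmetric dest: G.no_loops' G'.no_loops')
qed

definition restrict_word :: "'a list \<Rightarrow> 'a set \<Rightarrow> 'a list" where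
  "restrict_word w B = filter (\<lambda>x. x \<in> B) w"

text \<open>The word \<open>ababa\<dots>\<close> of length \<open>n\<close>.\<close>

definition alternating_word :: "'a \<Rightarrow> 'a \<Rightarrow> nat \<Rightarrow> 'a list" where
  "alternating_word a b n = map (\<lambda>i. if even i then a else b) [0..<n]"

definition alternate :: "'a list \<Rightarrow> 'a \<Rightarrow> 'a \<Rightarrow> bool" where
  "alternate w a b \<longleftrightarrow> (\<exists>n. restrict_word w {a, b} = alternating_word a b n \<or>
                            restrict_word w {a, b} = alternating_word b a n)"

definition represents :: "'a list \<Rightarrow> 'a pair_pre_digraph \<Rightarrow> bool" where
  "represents w G \<longleftrightarrow> set w \<subseteq> pverts G \<and>
     (\<forall>a \<in> pverts G. \<forall>b \<in> pverts G. a \<noteq> b \<longrightarrow> ((a, b) \<in> parcs G \<longleftrightarrow> alternate w a b))"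

definition word_representable :: "'a pair_pre_digraph \<Rightarrow> bool" where
  "word_representable G \<longleftrightarrow> (\<exists>w. represents w G)"

text \<open>
  The condition \<open>0 < k\<close> in the next two notions makes every vertex occur in the word; for
  \<open>k = 0\<close> the empty word would represent every complete graph.
\<close>

definition k_word_representable :: "nat \<Rightarrow> 'a pair_pre_digraph \<Rightarrow> bool" where
  "k_word_representable k G \<longleftrightarrow> 0 < k \<and>
     (\<exists>w. represents w G \<and> (\<forall>v \<in> pverts G. count_list w v = k))"

definition permutationally_k_representable :: "nat \<Rightarrow> 'a pair_pre_digraph \<Rightarrow> bool" where
  "permutationally_k_representable k G \<longleftrightarrow> 0 < k \<and>
     (\<exists>ps. length ps = k \<and> set ps \<subseteq> permutations_of_set (pverts G) \<and> represents (concat ps) G)"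

text \<open>An orientation \<open>r\<close> picks exactly one of the two directions of every edge.\<close>

definition comparability_graph :: "'a pair_pre_digraph \<Rightarrow> bool" where
  "comparability_graph G \<longleftrightarrow> (\<exists>r. r \<union> r\<inverse> = parcs G \<and> r \<inter> r\<inverse> = {} \<and> trans r)"

text \<open>
  These numbers carry meaning only for word-representable graphs and for comparability
  graphs, respectively.
\<close>

definition representation_number :: "'a pair_pre_digraph \<Rightarrow> nat" where
  "representation_number G = (LEAST k. k_word_representable k G)"

definition permutation_representation_number :: "'a pair_pre_digraph \<Rightarrow> nat" where
  "permutation_representation_number G = (LEAST k. permutationally_k_representable k G)"

end

theory Submission
  imports Defs
begin

text \<open>
  Both parts of the theorem follow from one equivalence: if \<open>G\<close> has an edge and \<open>H\<close> has a vertex,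
  then \<open>G[H]\<close> has a \<open>k\<close>-uniform representing word iff \<open>G\<close> has one and \<open>H\<close> has a permutational
  representation by \<open>k\<close> permutations (\<open>k_word_representable_lex_product_iff\<close>). Connected
  graphs have a vertex, and an edge if they have two vertices.

  From right to left, replace the \<open>i\<close>-th occurrence of a letter \<open>a\<close> in a \<open>k\<close>-uniform word for \<open>G\<close>
  by the \<open>i\<close>-th permutation of \<open>H\<close>, written in the column \<open>{a} \<times> H\<close>. Two letters of different
  columns then alternate like their first components in the word for \<open>G\<close>, and two letters of one
  column like their second components in the concatenated permutations.

  From left to right, \<open>G\<close> is an induced subgraph of \<open>G[H]\<close>, so deleting letters suffices for \<open>G\<close>.
  For \<open>H\<close>, take an edge \<open>ab\<close> of \<open>G\<close>: a vertex of column \<open>a\<close> is adjacent to all of column \<open>b\<close>. A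
  uniform word can be rotated without changing the graph, so let it begin with this vertex.
  Between two consecutive occurrences of the vertex, and after the last one, every letter of
  column \<open>b\<close> then occurs exactly once, so the word restricted to column \<open>b\<close> is a concatenation of \<open>k\<close> permutations
  (\<open>permutationally_k_representable_of_common_neighbour\<close>).

  It remains to know that representability by \<open>k\<close>-uniform words and by \<open>k\<close> permutations is monotone
  in \<open>k\<close>, so that the least common \<open>k\<close> is the maximum of the two minima; that every representing
  word can be made uniform (\<open>word_representable_iff_k_word_representable\<close>); and that permutational
  representability for some \<open>k\<close> means having a transitive orientation. The last fact holds because a
  finite strict order is the intersection of its linear extensions.
\<close>

section \<open>Alternation as the absence of equal neighbours\<close>

lemma restrict_word_simps [simp]:
  "restrict_word [] B = []"
  "restrict_word (x # w) B = (if x \<in> B then x # restrict_word w B else restrict_word w B)"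
  "restrict_word (u @ w) B = restrict_word u B @ restrict_word w B"
  "restrict_word (restrict_word w C) B = restrict_word w (B \<inter> C)"
  "set (restrict_word w B) = set w \<inter> B"
  by (auto simp: restrict_word_def conj_commute)

lemma count_list_restrict_word [simp]:
  "count_list (restrict_word w B) x = (if x \<in> B then count_list w x else 0)"
  by (induction w) auto

lemma restrict_word_insert_notin:
  "x \<notin> set w \<Longrightarrow> restrict_word w (insert x B) = restrict_word w B"
  unfolding restrict_word_def by (intro filter_cong) auto

lemma restrict_word_singleton:
  "distinct w \<Longrightarrow> restrict_word w {x} = (if x \<in> set w then [x] else [])"
  by (induction w) auto

lemma restrict_word_map: "restrict_word (map f w) B = map f (restrict_word w (f -` B))"
  by (induction w) auto

lemma restrict_word_concat: "restrict_word (concat ws) B = concat (map (\<lambda>w. restrict_word w B) ws)"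
  by (induction ws) auto

lemma distinct_adj_alternating_word:
  assumes "a \<noteq> b"
  shows "distinct_adj (alternating_word a b n)"
  using assms by (auto simp: distinct_adj_conv_nth alternating_word_def)

lemma alternating_word_Suc: "alternating_word a b (Suc n) = a # alternating_word b a n"
  by (auto simp: alternating_word_def map_upt_Suc simp del: upt_Suc)

lemma distinct_adj_imp_alternating_word:
  assumes "distinct_adj r" "set r \<subseteq> {a, b}" "r = [] \<or> hd r = a"
  shows "r = alternating_word a b (length r)"
  using assms
proof (induction r arbitrary: a b)
  case Nil
  then show ?case by (simp add: alternating_word_def)
next
  case (Cons c r)
  have "r = alternating_word b a (length r)"
    using Cons.prems by (intro Cons.IH) (cases r, auto)+
  then show ?case
    using Cons.prems by (simp add: alternating_word_Suc)
qed

text \<open>A word over two letters is alternating as soon as no letter is followed by itself. In this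
  form alternation is compatible with concatenation and with injective renaming, and every later
  argument uses only this form.\<close>

lemma alternate_iff_distinct_adj:
  assumes "a \<noteq> b"
  shows "alternate w a b \<longleftrightarrow> distinct_adj (restrict_word w {a, b})"
proof
  assume "alternate w a b"
  then show "distinct_adj (restrict_word w {a, b})"
    using assms distinct_adj_alternating_word by (fastforce simp: alternate_def)
next
  assume *: "distinct_adj (restrict_word w {a, b})"
  let ?r = "restrict_word w {a, b}"
  have "set ?r \<subseteq> {a, b}" by auto
  then consider "?r = [] \<or> hd ?r = a" | "?r = [] \<or> hd ?r = b"
    by (cases ?r) auto
  then show "alternate w a b"
  proof cases
    case 1
    then show ?thesis
      using distinct_adj_imp_alternating_word[OF *, of a b] by (auto simp: alternate_def)
  next
    case 2
    then show ?thesis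
      using distinct_adj_imp_alternating_word[OF *, of b a] by (auto simp: alternate_def)
  qed
qed

lemma represents_iff_distinct_adj:
  "represents w G \<longleftrightarrow> set w \<subseteq> pverts G \<and>
     (\<forall>a \<in> pverts G. \<forall>b \<in> pverts G. a \<noteq> b \<longrightarrow>
        ((a, b) \<in> parcs G \<longleftrightarrow> distinct_adj (restrict_word w {a, b})))"
  by (auto simp: represents_def alternate_iff_distinct_adj)

text \<open>In an alternating word the two letters occur equally often, except that the first letter
  occurs once more if it is also the last one. Padding and rotation rest on this count.\<close>

lemma count_alternating:
  assumes "distinct_adj r" "set r \<subseteq> {x, y}" "x \<noteq> y" "r \<noteq> []" "hd r = x"
  shows "count_list r x = count_list r y + (if last r = x then 1 else 0)"
  using assms(4,1-3,5)
proof (induction r arbitrary: x y rule: list_nonempty_induct)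
  case (single c)
  then show ?case by simp
next
  case (cons c r)
  have "hd r = y" "distinct_adj r"
    using cons.prems cons.hyps by (cases r; auto)+
  then have "count_list r y = count_list r x + (if last r = y then 1 else 0)"
    using cons.prems by (intro cons.IH) auto
  moreover have "last r \<in> {x, y}"
    using cons.prems cons.hyps last_in_set by fastforce
  ultimately show ?case
    using cons.prems cons.hyps by auto
qed

lemma count_le_of_last:
  assumes "distinct_adj r" "set r \<subseteq> {x, y}" "x \<noteq> y" "r \<noteq> []" "last r = x"
  shows "count_list r y \<le> count_list r x"
proof -
  have "hd r \<in> {x, y}" using assms hd_in_set by fastforce
  then show ?thesis
    using count_alternating[of r x y] count_alternating[of r y x] assms
    by (auto simp: insert_commute)
qed

lemma hd_neq_last_of_count_eq:
  assumes "distinct_adj r" "set r \<subseteq> {x, y}" "x \<noteq> y" "r \<noteq> []" "count_list r x = count_list r y"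
  shows "hd r \<noteq> last r"
proof -
  have "hd r \<in> {x, y}" using assms hd_in_set by fastforce
  then show ?thesis
    using count_alternating[of r x y] count_alternating[of r y x] assms
    by (auto simp: insert_commute)
qed

section \<open>Uniform representing words\<close>

lemma count_list_distinct: "distinct xs \<Longrightarrow> count_list xs x = (if x \<in> set xs then 1 else 0)"
  by (induction xs) auto

lemma remdups_restrict_word: "remdups (restrict_word w B) = restrict_word (remdups w) B"
  by (simp add: restrict_word_def remdups_filter)

lemma last_remdups: "last (remdups xs) = last xs"
  by (induction xs) auto

text \<open>The list \<open>remdups w\<close> orders the letters by their last occurrence, so appending it continues
  every alternating pair correctly. Appending only the letters of a set \<open>P\<close> is still harmless if they
  occur less often than the other vertices: an alternating pair with just one letter in \<open>P\<close> cannot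
  end in that letter, which may therefore be appended.\<close>

lemma represents_append_last_occurrences:
  assumes w: "represents w G"
    and occ: "pverts G \<subseteq> set w"
    and less: "\<And>x y. x \<in> P \<Longrightarrow> y \<in> pverts G - P \<Longrightarrow> count_list w x < count_list w y"
  shows "represents (w @ restrict_word (remdups w) P) G"
proof -
  have main: "distinct_adj (restrict_word (w @ restrict_word (remdups w) P) {a, b}) \<longleftrightarrow>
      distinct_adj (restrict_word w {a, b})"
    if ab: "a \<in> pverts G" "b \<in> pverts G" "a \<noteq> b" for a b
  proof -
    define r where "r = restrict_word w {a, b}"
    have r: "set r = {a, b}" using ab occ by (auto simp: r_def)
    then have ne: "r \<noteq> []" by auto
    have split: "restrict_word (w @ restrict_word (remdups w) P) {a, b} =
        r @ restrict_word (remdups r) P"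
      by (simp add: r_def remdups_restrict_word Int_commute)
    obtain c d where cd: "remdups r = [c, d]"
    proof -
      have "length (remdups r) = 2"
        using r ab(3) by (metis card_2_iff length_remdups_card_conv)
      then show thesis using that by (auto simp: length_Suc_conv numeral_2_eq_2)
    qed
    have d: "d = last r" using cd last_remdups[of r] by simp
    have set_cd: "{c, d} = {a, b}" "c \<noteq> d"
      using r cd set_remdups[of r] distinct_remdups[of r] by simp_all
    then have set_r: "set r = {d, c}" using r by blast
    have last_le: "distinct_adj r \<Longrightarrow> count_list r c \<le> count_list r d"
      by (rule count_le_of_last[OF _ equalityD1[OF set_r] set_cd(2)[symmetric] ne d[symmetric]])
    have "c \<in> {a, b}" "d \<in> {a, b}" using set_cd(1) by blast+
    then have cnt: "count_list r c = count_list w c" "count_list r d = count_list w d"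
      unfolding r_def by simp_all
    have "c \<in> pverts G" using \<open>c \<in> {a, b}\<close> ab(1,2) by auto
    \<comment> \<open>Only this case could spoil the alternation: the appended letter \<open>d\<close> repeats the last one.\<close>
    then have "\<not> (distinct_adj r \<and> d \<in> P \<and> c \<notin> P)"
      using last_le less[of d c] cnt by (metis DiffI leD)
    then show ?thesis
      using ne set_cd(2) d unfolding split cd r_def[symmetric]
      by (auto simp: distinct_adj_append_iff)
  qed
  show ?thesis
    using w main unfolding represents_iff_distinct_adj by auto
qed

text \<open>Any bound \<open>K\<close> on the numbers of occurrences can be attained by all letters at once, by
  repeatedly appending the letters that still occur too rarely. For a word that is already uniform
  this says that representability by \<open>k\<close>-uniform words is monotone in \<open>k\<close>.\<close>

lemma k_word_representable_of_bounded:
  assumes "represents w G" "0 < K"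
    and "\<And>v. v \<in> pverts G \<Longrightarrow> 1 \<le> count_list w v \<and> count_list w v \<le> K"
  shows "k_word_representable K G"
proof -
  have "k_word_representable K G"
    if "represents w G"
      "\<And>v. v \<in> pverts G \<Longrightarrow> 1 \<le> count_list w v \<and> count_list w v \<le> K \<and> K \<le> count_list w v + n"
    for n w
    using that
  proof (induction n arbitrary: w)
    case 0
    then show ?case
      using assms(2) by (fastforce simp: k_word_representable_def)
  next
    case (Suc n)
    define P where "P = {v \<in> pverts G. count_list w v < K}"
    have occ: "pverts G \<subseteq> set w"
      using Suc.prems(2) by (metis count_notin not_one_le_zero subsetI)
    have cnt: "count_list (w @ restrict_word (remdups w) P) v =
        count_list w v + (if v \<in> P then 1 else 0)" if "v \<in> pverts G" for v
      using occ that by (auto simp: count_list_distinct)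
    have "represents (w @ restrict_word (remdups w) P) G"
    proof (rule represents_append_last_occurrences[OF Suc.prems(1) occ])
      fix x y assume "x \<in> P" "y \<in> pverts G - P"
      then show "count_list w x < count_list w y" by (auto simp: P_def)
    qed
    then show ?case
    proof (rule Suc.IH)
      fix v assume v: "v \<in> pverts G"
      show "1 \<le> count_list (w @ restrict_word (remdups w) P) v \<and>
          count_list (w @ restrict_word (remdups w) P) v \<le> K \<and>
          K \<le> count_list (w @ restrict_word (remdups w) P) v + n"
        using Suc.prems(2)[OF v] v unfolding cnt[OF v] by (auto simp: P_def)
    qed
  qed
  from this[OF assms(1), of K] show ?thesis using assms(3) by fastforce
qed

lemma k_word_representable_mono:
  assumes "k_word_representable k G" "k \<le> m"
  shows "k_word_representable m G"
proof -
  obtain w where w: "represents w G" "\<forall>v \<in> pverts G. count_list w v = k" "0 < k"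
    using assms(1) by (auto simp: k_word_representable_def)
  show ?thesis
    by (rule k_word_representable_of_bounded[OF w(1)]) (use w(2,3) assms(2) in simp_all)
qed

text \<open>A representing word may omit vertices, and then it cannot be padded at once. An omitted vertex
  alternates exactly with the vertices that occur at most once, and this does not change when all
  omitted vertices are written once in front of the word.\<close>

lemma word_representable_iff_k_word_representable:
  assumes "finite (pverts G)"
  shows "word_representable G \<longleftrightarrow> (\<exists>k. k_word_representable k G)"
proof
  assume "word_representable G"
  then obtain w where w: "represents w G" by (auto simp: word_representable_def)
  obtain m where m: "set m = pverts G - set w" "distinct m"
    using finite_distinct_list[of "pverts G - set w"] assms by auto
  have main: "distinct_adj (restrict_word (m @ w) {a, b}) \<longleftrightarrow>
      distinct_adj (restrict_word w {a, b})"
    if ab: "a \<in> pverts G" "b \<in> pverts G" "a \<noteq> b" for a b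
  proof -
    have one: "restrict_word m {x, y} = [x]" "restrict_word w {x, y} = restrict_word w {y}"
      if "x \<in> set m" "y \<notin> set m" for x y
      using that m restrict_word_insert_notin[of y m "{x}"]
      by (auto simp: insert_commute restrict_word_insert_notin restrict_word_singleton)
    consider "a \<notin> set m" "b \<notin> set m" | "a \<in> set m" "b \<notin> set m" | "a \<notin> set m" "b \<in> set m"
      | "a \<in> set m" "b \<in> set m" by blast
    then show ?thesis
    proof cases
      case 1
      then have "restrict_word m {a, b} = []"
        by (auto simp: restrict_word_def filter_empty_conv)
      then show ?thesis by simp
    next
      case 2
      have "a \<noteq> hd (restrict_word w {b})" if "restrict_word w {b} \<noteq> []"
        using hd_in_set[OF that] ab(3) by auto
      then show ?thesis
        using one[OF 2] by (auto simp: distinct_adj_Cons)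
    next
      case 3
      have "b \<noteq> hd (restrict_word w {a})" if "restrict_word w {a} \<noteq> []"
        using hd_in_set[OF that] ab(3) by auto
      then show ?thesis
        using one[OF 3(2,1)] by (auto simp: distinct_adj_Cons insert_commute)
    next
      case 4
      then have "restrict_word w {a, b} = []"
        using m(1) by (auto simp: restrict_word_def filter_empty_conv)
      moreover have "distinct_adj (restrict_word m {a, b})"
        using m(2) by (simp add: restrict_word_def distinct_adj_conv_nth nth_eq_iff_index_eq)
      ultimately show ?thesis by simp
    qed
  qed
  have rep: "represents (m @ w) G"
    using w m main unfolding represents_iff_distinct_adj by auto
  \<comment> \<open>Any positive bound on the numbers of occurrences will do; the successor keeps it positive
    for the empty word.\<close>
  have "k_word_representable (Suc (length (m @ w))) G"
  proof (rule k_word_representable_of_bounded[OF rep])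
    fix v assume "v \<in> pverts G"
    then have "v \<in> set (m @ w)" using m by auto
    then have "count_list (m @ w) v \<noteq> 0" by (simp only: count_list_0_iff not_not)
    then show "1 \<le> count_list (m @ w) v \<and> count_list (m @ w) v \<le> Suc (length (m @ w))"
      using count_le_length[of "m @ w" v] by linarith
  qed simp
  then show "\<exists>k. k_word_representable k G" ..
qed (auto simp: k_word_representable_def word_representable_def)

text \<open>Rotating a word only matters for a pair of letters where the two parts are glued together;
  for an alternating pair with equal numbers of occurrences the first and the last letter differ,
  so the glueing is harmless.\<close>

lemma distinct_adj_rotate:
  assumes "distinct_adj (u @ v)" "set (u @ v) \<subseteq> {x, y}" "x \<noteq> y"
    "count_list (u @ v) x = count_list (u @ v) y"
  shows "distinct_adj (v @ u)"
proof (cases "u = [] \<or> v = []")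
  case True
  then show ?thesis using assms by auto
next
  case False
  then show ?thesis
    using hd_neq_last_of_count_eq[OF assms(1-3) _ assms(4)] assms(1)
    by (auto simp: distinct_adj_append_iff)
qed

lemma represents_rotate:
  assumes "represents (u @ v) G" "\<forall>x \<in> pverts G. count_list (u @ v) x = k"
  shows "represents (v @ u) G"
proof -
  have "distinct_adj (restrict_word (u @ v) {a, b}) \<longleftrightarrow> distinct_adj (restrict_word (v @ u) {a, b})"
    if "a \<in> pverts G" "b \<in> pverts G" "a \<noteq> b" for a b
    using distinct_adj_rotate[of "restrict_word u {a, b}" "restrict_word v {a, b}" a b]
      distinct_adj_rotate[of "restrict_word v {a, b}" "restrict_word u {a, b}" a b]
      assms(2) that by (auto simp: add.commute)
  then show ?thesis
    using assms(1) unfolding represents_iff_distinct_adj by auto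
qed

section \<open>Induced subgraphs\<close>

definition induced_embedding ::
    "('c \<Rightarrow> 'd) \<Rightarrow> 'c pair_pre_digraph \<Rightarrow> 'd pair_pre_digraph \<Rightarrow> bool" where
  "induced_embedding f K H \<longleftrightarrow> inj_on f (pverts K) \<and> f ` pverts K \<subseteq> pverts H \<and>
     (\<forall>a \<in> pverts K. \<forall>b \<in> pverts K. (f a, f b) \<in> parcs H \<longleftrightarrow> (a, b) \<in> parcs K)"

definition pull_back :: "('c \<Rightarrow> 'd) \<Rightarrow> 'c set \<Rightarrow> 'd list \<Rightarrow> 'c list" where
  "pull_back f V w = map (inv_into V f) (restrict_word w (f ` V))"

lemma restrict_word_pull_back:
  assumes "inj_on f V" "a \<in> V" "b \<in> V"
  shows "restrict_word (pull_back f V w) {a, b} =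
    map (inv_into V f) (restrict_word w {f a, f b})"
  using assms by (induction w) (auto simp: pull_back_def inj_on_eq_iff)

lemma count_list_pull_back:
  assumes "inj_on f V" "a \<in> V"
  shows "count_list (pull_back f V w) a = count_list w (f a)"
  using assms by (induction w) (auto simp: pull_back_def inj_on_eq_iff)

lemma represents_pull_back:
  assumes f: "induced_embedding f K H" and w: "represents w H"
  shows "represents (pull_back f (pverts K) w) K"
proof -
  have inj: "inj_on f (pverts K)" using f by (simp add: induced_embedding_def)
  have "distinct_adj (restrict_word (pull_back f (pverts K) w) {a, b}) \<longleftrightarrow> (a, b) \<in> parcs K"
    if ab: "a \<in> pverts K" "b \<in> pverts K" "a \<noteq> b" for a b
  proof -
    have "inj_on (inv_into (pverts K) f) (set (restrict_word w {f a, f b}))"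
      by (rule inj_on_subset[OF inj_on_inv_into[of "f ` pverts K"]]) (use ab in auto)
    moreover have "f a \<in> pverts H" "f b \<in> pverts H" "f a \<noteq> f b"
      using f ab by (auto simp: induced_embedding_def inj_on_eq_iff)
    then have "distinct_adj (restrict_word w {f a, f b}) \<longleftrightarrow> (f a, f b) \<in> parcs H"
      using w by (simp add: represents_iff_distinct_adj)
    ultimately show ?thesis
      using f ab
      by (simp add: restrict_word_pull_back[OF inj] distinct_adj_map_iff induced_embedding_def)
  qed
  moreover have "set (pull_back f (pverts K) w) \<subseteq> pverts K"
    by (auto simp: pull_back_def inv_into_into inj)
  ultimately show ?thesis by (simp add: represents_iff_distinct_adj)
qed

lemma k_word_representable_induced:
  assumes "induced_embedding f K H" "k_word_representable k H"
  shows "k_word_representable k K"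
proof -
  obtain w where "0 < k" "represents w H" "\<forall>v \<in> pverts H. count_list w v = k"
    using assms(2) by (auto simp: k_word_representable_def)
  moreover from this have "\<forall>v \<in> pverts K. count_list (pull_back f (pverts K) w) v = k"
    using assms(1) by (auto simp: count_list_pull_back induced_embedding_def)
  ultimately show ?thesis
    using represents_pull_back[OF assms(1)] by (auto simp: k_word_representable_def)
qed

section \<open>A vertex alternating with a whole set\<close>

lemma distinct_of_count_list_eq_1: "(\<And>x. x \<in> set xs \<Longrightarrow> count_list xs x = 1) \<Longrightarrow> distinct xs"
proof (induction xs)
  case (Cons a xs)
  have a: "a \<notin> set xs" using Cons.prems[of a] by (simp add: count_list_0_iff)
  have "count_list xs x = 1" if "x \<in> set xs" for x
    using Cons.prems[of x] that a by (cases "a = x") auto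
  then show ?case using Cons.IH a by simp
qed simp

text \<open>If \<open>b\<close> alternates with \<open>x\<close>, there is at most one \<open>x\<close> between two occurrences of \<open>b\<close> and at least
  one between consecutive ones. After the last \<open>b\<close>, it is the equality of the numbers of occurrences
  that forces \<open>x\<close> to appear once more.\<close>

lemma permutation_blocks:
  assumes "v = [] \<or> hd v = b" "set v \<subseteq> insert b N" "b \<notin> N"
    and "\<And>x. x \<in> N \<Longrightarrow> distinct_adj (restrict_word v {b, x}) \<and> count_list v x = count_list v b"
  shows "\<exists>ps. length ps = count_list v b \<and> set ps \<subseteq> permutations_of_set N \<and>
    concat ps = restrict_word v N"
  using assms
proof (induction v rule: length_induct)
  case (1 v)
  show ?case
  proof (cases v)
    case Nil
    then show ?thesis by simp
  next
    case (Cons c u)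
    define s where "s = takeWhile (\<lambda>x. x \<noteq> b) u"
    define t where "t = dropWhile (\<lambda>x. x \<noteq> b) u"
    have v: "v = b # s @ t"
      using Cons "1.prems"(1) by (simp add: s_def t_def)
    have t: "t = [] \<or> hd t = b"
      using hd_dropWhile[of "\<lambda>x. x \<noteq> b" u] by (auto simp: t_def)
    have b: "b \<notin> set s" by (auto simp: s_def dest: set_takeWhileD)
    then have s: "set s \<subseteq> N" using "1.prems"(2) v by auto
    \<comment> \<open>No \<open>x\<close> in \<open>s\<close> would make two occurrences of \<open>b\<close> neighbours, or \<open>b\<close> more frequent than \<open>x\<close> if
      this is the last block; two would be neighbours themselves.\<close>
    have once: "count_list s x = 1" if x: "x \<in> N" for x
    proof -
      have "x \<noteq> b" using x "1.prems"(3) by auto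
      have "restrict_word s {b, x} = restrict_word s {x}"
        using b by (rule restrict_word_insert_notin)
      also have "\<dots> = replicate (count_list s x) x" by (induction s) auto
      finally have alt: "distinct_adj (b # replicate (count_list s x) x @ restrict_word t {b, x})"
        using "1.prems"(4)[OF x] v by simp
      have "count_list s x \<noteq> 0"
      proof
        assume 0: "count_list s x = 0"
        then show False
          using t alt "1.prems"(4)[OF x] v b \<open>x \<noteq> b\<close> by (cases t) auto
      qed
      moreover have "count_list s x < 2"
      proof (rule ccontr)
        assume "\<not> count_list s x < 2"
        then obtain n where "count_list s x = Suc (Suc n)"
          by (metis add_2_eq_Suc le_iff_add not_less)
        then show False using alt by simp
      qed
      ultimately show ?thesis by linarith
    qed
    have "set s = N" using s once by (metis count_notin subsetI subset_antisym zero_neq_one)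
    moreover from this once have "distinct s" by (intro distinct_of_count_list_eq_1) auto
    ultimately have sN: "s \<in> permutations_of_set N" by (simp add: permutations_of_set_def)
    have "\<exists>ps. length ps = count_list t b \<and> set ps \<subseteq> permutations_of_set N \<and>
      concat ps = restrict_word t N"
    proof (rule "1.IH"[rule_format])
      fix x assume x: "x \<in> N"
      then have "x \<noteq> b" using "1.prems"(3) by auto
      have "restrict_word v {b, x} = (b # restrict_word s {b, x}) @ restrict_word t {b, x}"
        using v by simp
      then have "distinct_adj (restrict_word t {b, x})"
        using "1.prems"(4)[OF x] by (metis distinct_adj_appendD2)
      then show "distinct_adj (restrict_word t {b, x}) \<and> count_list t x = count_list t b"
        using "1.prems"(4)[OF x] v once[OF x] b \<open>x \<noteq> b\<close> by auto
    qed (use t v "1.prems" in auto)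
    then obtain ps where ps: "length ps = count_list t b" "set ps \<subseteq> permutations_of_set N"
      "concat ps = restrict_word t N" by blast
    have "restrict_word s N = s" using s by (auto simp: restrict_word_def filter_id_conv)
    then have "length (s # ps) = count_list v b \<and> set (s # ps) \<subseteq> permutations_of_set N \<and>
        concat (s # ps) = restrict_word v N"
      using ps sN v b "1.prems"(3) by auto
    then show ?thesis by blast
  qed
qed

text \<open>The common neighbour \<open>b\<close> cuts a uniform word into permutations of its neighbours once the word
  begins with \<open>b\<close>. Without the rotation, the part before the first \<open>b\<close> and the part after the last
  one would only together form a permutation.\<close>

lemma permutationally_k_representable_of_common_neighbour:
  assumes f: "induced_embedding f K H" and k: "k_word_representable k H"
    and b: "b \<in> pverts H" "b \<notin> f ` pverts K"
    and adj: "\<And>x. x \<in> pverts K \<Longrightarrow> (b, f x) \<in> parcs H"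
  shows "permutationally_k_representable k K"
proof -
  let ?N = "f ` pverts K"
  have inj: "inj_on f (pverts K)" and NH: "?N \<subseteq> pverts H"
    using f by (auto simp: induced_embedding_def)
  obtain w where w: "0 < k" "represents w H" "\<forall>v \<in> pverts H. count_list w v = k"
    using k by (auto simp: k_word_representable_def)
  have "b \<in> set w" using w(1,3) b(1) by (metis count_notin less_irrefl)
  then obtain u v where uv: "w = u @ b # v" by (meson split_list)
  define w' where "w' = (b # v) @ u"
  have w': "represents w' H" "\<forall>v \<in> pverts H. count_list w' v = k"
    using represents_rotate[of u "b # v" H k] w uv by (auto simp: w'_def)
  obtain ps where ps: "length ps = k" "set ps \<subseteq> permutations_of_set ?N"
    "concat ps = restrict_word w' ?N"
  proof -
    let ?v = "restrict_word w' (insert b ?N)"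
    have "\<exists>ps. length ps = count_list ?v b \<and> set ps \<subseteq> permutations_of_set ?N \<and>
        concat ps = restrict_word ?v ?N"
    proof (rule permutation_blocks)
      show "?v = [] \<or> hd ?v = b" by (simp add: w'_def)
      fix y assume y: "y \<in> ?N"
      then have yH: "y \<in> pverts H" "y \<noteq> b" "(b, y) \<in> parcs H"
        using NH b(2) adj by auto
      then have "distinct_adj (restrict_word w' {b, y})"
        using w'(1) b(1) by (simp add: represents_iff_distinct_adj)
      moreover have "{b, y} \<inter> insert b ?N = {b, y}" using y by auto
      ultimately show "distinct_adj (restrict_word ?v {b, y}) \<and> count_list ?v y = count_list ?v b"
        using w'(2) yH b(1) y by simp
    qed (use b in auto)
    moreover have "count_list ?v b = k" using w'(2) b(1) by simp
    moreover have "?N \<inter> insert b ?N = ?N" by auto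
    ultimately show thesis using that by auto
  qed
  define qs where "qs = map (map (inv_into (pverts K) f)) ps"
  have "map (inv_into (pverts K) f) p \<in> permutations_of_set (pverts K)"
    if "p \<in> permutations_of_set ?N" for p
    using that inj by (auto simp: permutations_of_set_def distinct_map inj_on_inv_into
        inv_into_into image_image)
  then have "set qs \<subseteq> permutations_of_set (pverts K)" using ps(2) by (auto simp: qs_def)
  moreover have "concat qs = pull_back f (pverts K) w'"
    by (simp add: qs_def pull_back_def map_concat[symmetric] ps(3))
  then have "represents (concat qs) K" using represents_pull_back[OF f w'(1)] by simp
  ultimately show ?thesis
    using ps(1) w(1) unfolding permutationally_k_representable_def
    by (intro conjI exI[of _ qs]) (simp_all add: qs_def)
qed

section \<open>Permutational representations and transitive orientations\<close>

primrec precedes :: "'a list \<Rightarrow> 'a \<Rightarrow> 'a \<Rightarrow> bool" where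
  "precedes [] x y \<longleftrightarrow> False"
| "precedes (a # p) x y \<longleftrightarrow> a = x \<and> y \<in> set p \<or> precedes p x y"

lemma precedes_imp_mem: "precedes p x y \<Longrightarrow> x \<in> set p \<and> y \<in> set p"
  by (induction p) auto

lemma precedes_asym: "distinct p \<Longrightarrow> precedes p x y \<Longrightarrow> \<not> precedes p y x"
  by (induction p) (auto dest: precedes_imp_mem)

lemma precedes_total: "x \<in> set p \<Longrightarrow> y \<in> set p \<Longrightarrow> x \<noteq> y \<Longrightarrow> precedes p x y \<or> precedes p y x"
  by (induction p) auto

lemma precedes_trans: "distinct p \<Longrightarrow> precedes p x y \<Longrightarrow> precedes p y z \<Longrightarrow> precedes p x z"
  by (induction p) (auto dest: precedes_imp_mem)

lemma restrict_word_pair: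
  assumes "distinct p" "x \<noteq> y" "precedes p x y"
  shows "restrict_word p {x, y} = [x, y]"
  using assms
  by (induction p)
    (auto simp: restrict_word_insert_notin restrict_word_singleton dest: precedes_imp_mem)

lemma distinct_adj_concat_pairs:
  assumes "x \<noteq> y" "set qs \<subseteq> {[x, y], [y, x]}"
  shows "distinct_adj (concat qs) \<longleftrightarrow> set qs \<subseteq> {[x, y]} \<or> set qs \<subseteq> {[y, x]}"
  using assms(2)
proof (induction qs)
  case (Cons q qs)
  then show ?case
    using assms(1) by (cases qs) (auto simp: distinct_adj_Cons)
qed simp

text \<open>Each permutation contributes \<open>ab\<close> or \<open>ba\<close>, and a concatenation of such blocks has no equal
  neighbours iff all blocks agree. Hence adjacency means that all permutations order the two vertices
  in the same way.\<close>

lemma represents_concat_permutations: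
  assumes "set ps \<subseteq> permutations_of_set (pverts G)"
  shows "represents (concat ps) G \<longleftrightarrow> (\<forall>a \<in> pverts G. \<forall>b \<in> pverts G. a \<noteq> b \<longrightarrow>
    ((a, b) \<in> parcs G \<longleftrightarrow> (\<forall>p \<in> set ps. precedes p a b) \<or> (\<forall>p \<in> set ps. precedes p b a)))"
proof -
  have "distinct_adj (restrict_word (concat ps) {a, b}) \<longleftrightarrow>
      (\<forall>p \<in> set ps. precedes p a b) \<or> (\<forall>p \<in> set ps. precedes p b a)"
    if ab: "a \<in> pverts G" "b \<in> pverts G" "a \<noteq> b" for a b
  proof -
    have p: "restrict_word p {a, b} \<in> {[a, b], [b, a]} \<and>
        (restrict_word p {a, b} = [a, b] \<longleftrightarrow> precedes p a b) \<and>
        (restrict_word p {a, b} = [b, a] \<longleftrightarrow> precedes p b a)" if "p \<in> set ps" for p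
    proof -
      have "distinct p" "set p = pverts G"
        using that assms by (auto simp: permutations_of_set_def)
      then consider "precedes p a b" "\<not> precedes p b a" "restrict_word p {a, b} = [a, b]"
        | "precedes p b a" "\<not> precedes p a b" "restrict_word p {b, a} = [b, a]"
        using ab precedes_total[of a p b] precedes_asym[of p a b] precedes_asym[of p b a]
          restrict_word_pair[of p a b] restrict_word_pair[of p b a] by metis
      moreover have "{b, a} = {a, b}" by blast
      ultimately show ?thesis using ab(3) by cases simp_all
    qed
    have "distinct_adj (restrict_word (concat ps) {a, b}) \<longleftrightarrow>
        (\<lambda>p. restrict_word p {a, b}) ` set ps \<subseteq> {[a, b]} \<or>
        (\<lambda>p. restrict_word p {a, b}) ` set ps \<subseteq> {[b, a]}"
      unfolding restrict_word_concat set_map[symmetric]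
      using p by (intro distinct_adj_concat_pairs[OF ab(3)]) auto
    then show ?thesis using p by (simp add: image_subset_iff)
  qed
  moreover have "set (concat ps) \<subseteq> pverts G"
    using assms by (auto simp: permutations_of_set_def)
  ultimately show ?thesis by (simp add: represents_iff_distinct_adj)
qed

text \<open>A permutation may be repeated, since only the set of permutations determines the graph.\<close>

lemma permutationally_k_representable_mono:
  assumes "permutationally_k_representable k G" "k \<le> m"
  shows "permutationally_k_representable m G"
proof -
  obtain ps where ps: "0 < k" "length ps = k" "set ps \<subseteq> permutations_of_set (pverts G)"
    "represents (concat ps) G"
    using assms(1) by (auto simp: permutationally_k_representable_def)
  define qs where "qs = replicate (m - k) (hd ps) @ ps"
  have "set qs = set ps" using ps(1,2) by (auto simp: qs_def)
  then have "represents (concat qs) G"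
    using ps(3,4) by (simp add: represents_concat_permutations)
  moreover have "length qs = m" using assms(2) ps(2) by (simp add: qs_def)
  ultimately show ?thesis
    using ps(1,3) assms(2) \<open>set qs = set ps\<close>
    unfolding permutationally_k_representable_def by auto
qed

text \<open>Orient every edge in the way in which all the permutations order its ends. This is transitive
  as an intersection of linear orders, and antisymmetric because there is at least one permutation.\<close>

lemma comparability_graph_of_permutationally_k_representable:
  assumes "pair_graph G" "permutationally_k_representable k G"
  shows "comparability_graph G"
proof -
  interpret pair_graph G by fact
  obtain ps where "0 < k" "length ps = k" and ps: "set ps \<subseteq> permutations_of_set (pverts G)"
    and rep: "represents (concat ps) G"
    using assms(2) by (auto simp: permutationally_k_representable_def)
  then have ne: "set ps \<noteq> {}" by auto
  have dist: "distinct p" if "p \<in> set ps" for p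
    using that ps by (auto simp: permutations_of_set_def)
  define r where "r = {(a, b) \<in> parcs G. \<forall>p \<in> set ps. precedes p a b}"
  have arc: "(a, b) \<in> parcs G \<longleftrightarrow>
      (\<forall>p \<in> set ps. precedes p a b) \<or> (\<forall>p \<in> set ps. precedes p b a)"
    if "a \<in> pverts G" "b \<in> pverts G" "a \<noteq> b" for a b
    using rep that unfolding represents_concat_permutations[OF ps] by blast
  have verts: "a \<in> pverts G \<and> b \<in> pverts G \<and> a \<noteq> b" if "(a, b) \<in> parcs G" for a b
    using that in_arcsD1 in_arcsD2 no_loops' by blast
  have sub: "r \<union> r\<inverse> = parcs G"
  proof (intro subset_antisym subrelI)
    fix a b assume "(a, b) \<in> r \<union> r\<inverse>"
    then show "(a, b) \<in> parcs G" by (auto simp: r_def intro: arcs_symmetric)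
  next
    fix a b assume "(a, b) \<in> parcs G"
    then show "(a, b) \<in> r \<union> r\<inverse>"
      using verts[of a b] arc[of a b] by (auto simp: r_def intro: arcs_symmetric)
  qed
  have asym: "r \<inter> r\<inverse> = {}"
  proof -
    obtain p where p: "p \<in> set ps" using ne by (meson ex_in_conv)
    show ?thesis using p precedes_asym[OF dist[OF p]] by (auto simp: r_def)
  qed
  have "trans r"
  proof (rule transI)
    fix a b c assume abc: "(a, b) \<in> r" "(b, c) \<in> r"
    have all: "\<forall>p \<in> set ps. precedes p a c"
    proof
      fix p assume p: "p \<in> set ps"
      then show "precedes p a c"
        using abc precedes_trans[OF dist[OF p], of a b c] by (simp add: r_def)
    qed
    moreover have "a \<noteq> c" using abc asym by auto
    ultimately show "(a, c) \<in> r"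
      using abc verts arc[of a c] by (auto simp: r_def)
  qed
  with sub asym show ?thesis unfolding comparability_graph_def by (intro exI[of _ r] conjI)
qed

text \<open>Topological sorting. For an order given as an acyclic relation \<open>A\<close>, being a linear extension is
  expressed by forbidding a later letter to be below an earlier one.\<close>

lemma ex_linear_extension:
  assumes "finite V" "acyclic A"
  shows "\<exists>p \<in> permutations_of_set V. sorted_wrt (\<lambda>x y. (y, x) \<notin> A) p"
  using assms(1)
proof (induction V rule: finite_psubset_induct)
  case (psubset V)
  show ?case
  proof (cases "V = {}")
    case True
    then show ?thesis by simp
  next
    case False
    have "finite (A \<inter> V \<times> V)" using psubset.hyps by auto
    moreover have "acyclic (A \<inter> V \<times> V)" using assms(2) by (rule acyclic_subset) auto
    ultimately have "wf (A \<inter> V \<times> V)" by (rule finite_acyclic_wf)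
    then obtain m where m: "m \<in> V" "\<And>y. (y, m) \<in> A \<inter> V \<times> V \<Longrightarrow> y \<notin> V"
      using False by (metis ex_in_conv wfE_min)
    from m(1) have "V - {m} \<subset> V" by auto
    then obtain p where p: "p \<in> permutations_of_set (V - {m})" "sorted_wrt (\<lambda>x y. (y, x) \<notin> A) p"
      using psubset.IH by blast
    have "set p = V - {m}" "distinct p" using p(1) by (simp_all add: permutations_of_set_def)
    moreover from this m have "\<forall>y \<in> set p. (y, m) \<notin> A" by blast
    ultimately have "m # p \<in> permutations_of_set V" "sorted_wrt (\<lambda>x y. (y, x) \<notin> A) (m # p)"
      using m(1) p(2) by (simp_all add: permutations_of_set_def insert_absorb)
    then show ?thesis by (rule bexI[rotated])
  qed
qed

lemma precedes_of_linear_extension: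
  assumes "sorted_wrt (\<lambda>x y. (y, x) \<notin> A) p" "(x, y) \<in> A" "x \<in> set p" "y \<in> set p" "x \<noteq> y"
  shows "precedes p x y"
  using assms by (induction p) auto

text \<open>Concatenate all linear extensions of a transitive orientation \<open>r\<close>. If \<open>a\<close> and \<open>b\<close> are not
  related by \<open>(a, b) \<in> r\<close>, then adding the pair \<open>(b, a)\<close> to \<open>r\<close> leaves it acyclic, so some linear
  extension puts \<open>b\<close> before \<open>a\<close>.\<close>

lemma permutationally_k_representable_of_comparability_graph:
  assumes "finite (pverts G)" "comparability_graph G"
  shows "\<exists>k. permutationally_k_representable k G"
proof -
  obtain r where r: "r \<union> r\<inverse> = parcs G" "r \<inter> r\<inverse> = {}" "trans r"
    using assms(2) by (auto simp: comparability_graph_def)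
  let ?E = "{p \<in> permutations_of_set (pverts G). sorted_wrt (\<lambda>x y. (y, x) \<notin> r) p}"
  have acyc: "acyclic r" using r(2,3) by (auto simp: acyclic_def trancl_id)
  have "finite ?E" using assms(1) by simp
  then obtain ps where ps: "set ps = ?E" using finite_list by blast
  have "?E \<noteq> {}" using ex_linear_extension[OF assms(1) acyc] by blast
  then have ne: "0 < length ps" using ps by force
  have iff: "(\<forall>p \<in> ?E. precedes p a b) \<longleftrightarrow> (a, b) \<in> r"
    if ab: "a \<in> pverts G" "b \<in> pverts G" "a \<noteq> b" for a b
  proof
    assume "(a, b) \<in> r"
    then show "\<forall>p \<in> ?E. precedes p a b"
      using ab by (auto intro!: precedes_of_linear_extension simp: permutations_of_set_def)
  next
    assume all: "\<forall>p \<in> ?E. precedes p a b"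
    show "(a, b) \<in> r"
    proof (rule ccontr)
      assume "(a, b) \<notin> r"
      then have "(a, b) \<notin> r\<^sup>*" using ab(3) r(3) by (simp add: rtrancl_eq_or_trancl trancl_id)
      then have "acyclic (insert (b, a) r)" using acyc by simp
      then obtain p where p: "p \<in> permutations_of_set (pverts G)"
        "sorted_wrt (\<lambda>x y. (y, x) \<notin> insert (b, a) r) p"
        using ex_linear_extension[OF assms(1)] by blast
      then have "precedes p b a"
        using ab by (intro precedes_of_linear_extension[OF p(2)]) (auto simp: permutations_of_set_def)
      moreover have "sorted_wrt (\<lambda>x y. (y, x) \<notin> r) p"
        using p(2) by (rule sorted_wrt_mono_rel[rotated]) auto
      ultimately show False
        using all p(1) precedes_asym[of p a b] by (auto simp: permutations_of_set_def)
    qed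
  qed
  have "represents (concat ps) G"
    using ps iff r(1) by (subst represents_concat_permutations) (auto simp: r(1)[symmetric])
  then show ?thesis
    using ps ne unfolding permutationally_k_representable_def by blast
qed

section \<open>The lexicographical product\<close>

lemma parcs_lex_product:
  "((a, x), (b, y)) \<in> parcs (lex_product G H) \<longleftrightarrow>
     a \<in> pverts G \<and> x \<in> pverts H \<and> b \<in> pverts G \<and> y \<in> pverts H \<and>
     ((a, b) \<in> parcs G \<or> a = b \<and> (x, y) \<in> parcs H)"
  by (auto simp: lex_product_def)

lemma pverts_lex_product [simp]: "pverts (lex_product G H) = pverts G \<times> pverts H"
  by (simp add: lex_product_def)

lemma loop_free: "pair_graph G \<Longrightarrow> (a, a) \<notin> parcs G"
proof
  assume "pair_graph G" "(a, a) \<in> parcs G"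
  then interpret pair_graph G by simp
  show False using \<open>(a, a) \<in> parcs G\<close> no_loops' by blast
qed

lemma induced_embedding_row:
  assumes "pair_graph H" "x \<in> pverts H"
  shows "induced_embedding (\<lambda>a. (a, x)) G (lex_product G H)"
proof -
  have "(x, x) \<notin> parcs H" using assms(1) by (rule loop_free)
  then show ?thesis
    using assms(2) by (auto simp: induced_embedding_def parcs_lex_product inj_on_def)
qed

lemma induced_embedding_column:
  assumes "pair_graph G" "a \<in> pverts G"
  shows "induced_embedding (Pair a) H (lex_product G H)"
proof -
  have "(a, a) \<notin> parcs G" using assms(1) by (rule loop_free)
  then show ?thesis
    using assms(2) by (auto simp: induced_embedding_def parcs_lex_product inj_on_def)
qed

text \<open>The list \<open>P a\<close> holds the permutations that are still to be used up by the remaining occurrences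
  of \<open>a\<close>: each occurrence takes the first one and is replaced by its copy in the column of \<open>a\<close>.\<close>

primrec inflate :: "('a \<Rightarrow> 'b list list) \<Rightarrow> 'a list \<Rightarrow> ('a \<times> 'b) list" where
  "inflate P [] = []"
| "inflate P (a # w) = map (Pair a) (hd (P a)) @ inflate (P(a := tl (P a))) w"

lemma restrict_word_inflate_column:
  assumes "\<And>a. length (P a) = count_list w a"
  shows "restrict_word (inflate P w) ({a} \<times> UNIV) = map (Pair a) (concat (P a))"
  using assms
proof (induction w arbitrary: P)
  case Nil
  then show ?case by simp
next
  case (Cons c w)
  have "length ((P(c := tl (P c))) b) = count_list w b" for b
    using Cons.prems[of b] by auto
  then have IH: "restrict_word (inflate (P(c := tl (P c))) w) ({a} \<times> UNIV) =
      map (Pair a) (concat ((P(c := tl (P c))) a))"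
    by (rule Cons.IH[where P = "P(c := tl (P c))"])
  have "restrict_word (map (Pair c) p) ({a} \<times> UNIV) = (if a = c then map (Pair c) p else [])" for p
    by (induction p) auto
  moreover have "P c \<noteq> []" using Cons.prems[of c] by auto
  then have "concat (P c) = hd (P c) @ concat (tl (P c))" by (cases "P c") simp_all
  ultimately show ?case using IH by (cases "a = c") simp_all
qed

text \<open>Each occurrence of \<open>a\<close> contributes exactly one \<open>(a, x)\<close>, whichever permutation it takes, so the
  pattern of two letters of different columns is the pattern of the columns.\<close>

lemma restrict_word_inflate_pair:
  assumes "\<And>a. length (P a) = count_list w a" "\<And>a. set (P a) \<subseteq> permutations_of_set V"
    and "a \<noteq> b" "x \<in> V" "y \<in> V"
  shows "restrict_word (inflate P w) {(a, x), (b, y)} =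
    map (\<lambda>c. if c = a then (a, x) else (b, y)) (restrict_word w {a, b})"
  using assms(1,2)
proof (induction w arbitrary: P)
  case Nil
  then show ?case by simp
next
  case (Cons c w)
  have ne: "P c \<noteq> []" using Cons.prems(1)[of c] by auto
  have "length ((P(c := tl (P c))) d) = count_list w d" for d
    using Cons.prems(1)[of d] by auto
  moreover have "set ((P(c := tl (P c))) d) \<subseteq> permutations_of_set V" for d
    using Cons.prems(2)[of d] ne by (auto dest: list.set_sel(2))
  ultimately have IH: "restrict_word (inflate (P(c := tl (P c))) w) {(a, x), (b, y)} =
      map (\<lambda>c. if c = a then (a, x) else (b, y)) (restrict_word w {a, b})"
    by (rule Cons.IH[where P = "P(c := tl (P c))"])
  have "hd (P c) \<in> permutations_of_set V" using ne Cons.prems(2)[of c] by auto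
  then have hd: "restrict_word (hd (P c)) {z} = [z]" if "z \<in> V" for z
    using that by (simp add: restrict_word_singleton permutations_of_set_def)
  have "Pair c -` {(a, x), (b, y)} = (if c = a then {x} else if c = b then {y} else {})"
    using assms(3) by auto
  moreover have "restrict_word (hd (P c)) {} = []" by (simp add: restrict_word_def)
  ultimately have "restrict_word (map (Pair c) (hd (P c))) {(a, x), (b, y)} =
      (if c = a then [(a, x)] else if c = b then [(b, y)] else [])"
    using hd[OF assms(4)] hd[OF assms(5)] unfolding restrict_word_map
    by (cases "c = a"; cases "c = b") simp_all
  then show ?case using IH by simp
qed

lemma k_word_representable_lex_product:
  assumes "pair_graph G" "pair_graph H"
    and "k_word_representable k G" "permutationally_k_representable k H"
  shows "k_word_representable k (lex_product G H)"
proof -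
  obtain w where w: "0 < k" "represents w G" "\<forall>v \<in> pverts G. count_list w v = k"
    using assms(3) by (auto simp: k_word_representable_def)
  obtain ps where ps: "length ps = k" "set ps \<subseteq> permutations_of_set (pverts H)"
    "represents (concat ps) H"
    using assms(4) by (auto simp: permutationally_k_representable_def)
  define P where "P a = (if a \<in> pverts G then ps else [])" for a
  define W where "W = inflate P w"
  have lenP: "length (P a) = count_list w a" for a
  proof (cases "a \<in> pverts G")
    case False
    then have "a \<notin> set w" using w(2) by (auto simp: represents_def)
    then show ?thesis using False by (simp add: P_def)
  qed (use w(3) ps(1) in \<open>simp add: P_def\<close>)
  have setP: "set (P a) \<subseteq> permutations_of_set (pverts H)" for a
    using ps(2) by (cases "a \<in> pverts G") (simp_all add: P_def)
  have column: "restrict_word W ({a} \<times> UNIV) = map (Pair a) (concat (P a))" for a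
    unfolding W_def by (rule restrict_word_inflate_column[OF lenP])
  have cnt: "count_list W (a, x) = k" if "a \<in> pverts G" "x \<in> pverts H" for a x
  proof -
    have "count_list W (a, x) = count_list (restrict_word W ({a} \<times> UNIV)) (a, x)" by simp
    also have "\<dots> = count_list (concat ps) x"
      using that(1) unfolding column by (simp add: P_def count_list_map_conv inj_on_def)
    also have "\<dots> = length ps"
      using ps(2) that(2)
      by (induction ps) (auto simp: permutations_of_set_def count_list_distinct)
    finally show ?thesis using ps(1) by simp
  qed
  have arc: "((a, x), (b, y)) \<in> parcs (lex_product G H) \<longleftrightarrow>
      distinct_adj (restrict_word W {(a, x), (b, y)})"
    if v: "a \<in> pverts G" "x \<in> pverts H" "b \<in> pverts G" "y \<in> pverts H" "(a, x) \<noteq> (b, y)"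
    for a x b y
  proof (cases "a = b")
    case True
    then have "x \<noteq> y" using v(5) by simp
    have "{(a, x), (a, y)} \<inter> {a} \<times> UNIV = {(a, x), (a, y)}" by auto
    then have "restrict_word W {(a, x), (a, y)} =
        restrict_word (restrict_word W ({a} \<times> UNIV)) {(a, x), (a, y)}" by simp
    also have "\<dots> = map (Pair a) (restrict_word (concat ps) {x, y})"
    proof -
      have "Pair a -` {(a, x), (a, y)} = {x, y}" by auto
      then show ?thesis unfolding column using v(1) by (simp add: restrict_word_map P_def)
    qed
    finally have "distinct_adj (restrict_word W {(a, x), (a, y)}) \<longleftrightarrow>
        distinct_adj (restrict_word (concat ps) {x, y})"
      by (simp add: distinct_adj_map_iff inj_on_def)
    moreover have "(a, a) \<notin> parcs G" using assms(1) by (rule loop_free)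
    ultimately show ?thesis
      using ps(3) v True \<open>x \<noteq> y\<close> by (simp add: parcs_lex_product represents_iff_distinct_adj)
  next
    case False
    have "inj_on (\<lambda>c. if c = a then (a, x) else (b, y)) (set (restrict_word w {a, b}))"
      using False by (auto simp: inj_on_def)
    then have "distinct_adj (restrict_word W {(a, x), (b, y)}) \<longleftrightarrow>
        distinct_adj (restrict_word w {a, b})"
      unfolding W_def restrict_word_inflate_pair[OF lenP setP False v(2,4)]
      by (rule distinct_adj_map_iff)
    then show ?thesis
      using w(2) v False by (simp add: parcs_lex_product represents_iff_distinct_adj)
  qed
  have "set W \<subseteq> pverts G \<times> pverts H"
  proof
    fix z assume z: "z \<in> set W"
    obtain a x where [simp]: "z = (a, x)" by (cases z)
    have "(a, x) \<in> set (restrict_word W ({a} \<times> UNIV))" using z by simp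
    then show "z \<in> pverts G \<times> pverts H"
      unfolding column using ps(2) by (auto simp: P_def permutations_of_set_def split: if_splits)
  qed
  then have "represents W (lex_product G H)"
    using arc by (auto simp: represents_iff_distinct_adj)
  then show ?thesis
    using w(1) cnt by (auto simp: k_word_representable_def)
qed

text \<open>The left-to-right direction embeds \<open>G\<close> as a row and \<open>H\<close> as the column of \<open>b\<close>; the vertex
  \<open>(a, x)\<close>, which lies outside this column, is adjacent to all of it.\<close>

lemma k_word_representable_lex_product_iff:
  assumes "pair_graph G" "pair_graph H" "(a, b) \<in> parcs G" "pverts H \<noteq> {}"
  shows "k_word_representable k (lex_product G H) \<longleftrightarrow>
    k_word_representable k G \<and> permutationally_k_representable k H"
proof
  interpret pair_graph G by fact
  have ab: "a \<in> pverts G" "b \<in> pverts G" "a \<noteq> b"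
    using assms(3) in_arcsD1 in_arcsD2 no_loops' by blast+
  obtain x where x: "x \<in> pverts H" using assms(4) by auto
  assume k: "k_word_representable k (lex_product G H)"
  have "k_word_representable k G"
    using induced_embedding_row[OF assms(2) x] k by (rule k_word_representable_induced)
  moreover have "permutationally_k_representable k H"
    by (rule permutationally_k_representable_of_common_neighbour[
          OF induced_embedding_column[OF assms(1) ab(2)] k, of "(a, x)"])
      (use ab x assms(3) in \<open>auto simp: parcs_lex_product\<close>)
  ultimately show "k_word_representable k G \<and> permutationally_k_representable k H" ..
next
  assume "k_word_representable k G \<and> permutationally_k_representable k H"
  then show "k_word_representable k (lex_product G H)"
    using k_word_representable_lex_product[OF assms(1,2)] by blast
qed

lemma finite_pverts: "pair_graph G \<Longrightarrow> finite (pverts G)"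
proof -
  assume "pair_graph G"
  then interpret pair_graph G .
  show ?thesis by (rule pair_finite_verts)
qed

lemma ex_arc_of_connected:
  assumes "pair_graph G" "Digraph_Component.connected (with_proj G)" "2 \<le> card (pverts G)"
  shows "\<exists>a b. (a, b) \<in> parcs G"
proof (rule ccontr)
  assume "\<nexists>a b. (a, b) \<in> parcs G"
  then have no: "parcs G = {}" by auto
  obtain u v where uv: "u \<in> pverts G" "v \<in> pverts G" "u \<noteq> v"
    using assms(3) by (metis card_le_Suc0_iff_eq card.infinite not_less_eq_eq numeral_2_eq_2 zero_le)
  then have "(u, v) \<in> rtrancl_on (pverts G) ({}\<^sup>s)"
    using assms(2) no unfolding connected_conv by simp
  then show False
    using uv(3) by (induction rule: rtrancl_on.induct) (auto simp: symcl_def)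
qed

theorem theorem6:
  fixes G :: "'a pair_pre_digraph" and G' :: "'b pair_pre_digraph"
  assumes "pair_graph G" and "Digraph_Component.connected (with_proj G)"
    and "pair_graph G'" and "Digraph_Component.connected (with_proj G')"
    and "2 \<le> card (pverts G)"
  shows "(word_representable (lex_product G G') \<longleftrightarrow>
            word_representable G \<and> comparability_graph G') \<and>
         (\<forall>k k'. word_representable G \<and> representation_number G = k \<and>
            comparability_graph G' \<and> permutation_representation_number G' = k' \<longrightarrow>
            representation_number (lex_product G G') = max k k')"
proof -
  obtain a b where ab: "(a, b) \<in> parcs G"
    using ex_arc_of_connected[OF assms(1,2,5)] by blast
  have ne: "pverts G' \<noteq> {}" using assms(4) by (simp add: connected_conv)
  have fin: "finite (pverts G)" "finite (pverts G')"
    using assms(1,3) finite_pverts by blast+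
  note prod = k_word_representable_lex_product_iff[OF assms(1,3) ab ne]
  have G: "word_representable G \<longleftrightarrow> (\<exists>k. k_word_representable k G)"
    using word_representable_iff_k_word_representable[OF fin(1)] .
  have G': "comparability_graph G' \<longleftrightarrow> (\<exists>k. permutationally_k_representable k G')"
    using permutationally_k_representable_of_comparability_graph[OF fin(2)]
      comparability_graph_of_permutationally_k_representable[OF assms(3)] by blast
  have up: "k_word_representable (max k l) (lex_product G G')"
    if "k_word_representable k G" "permutationally_k_representable l G'" for k l
    unfolding prod using k_word_representable_mono[OF that(1), of "max k l"]
      permutationally_k_representable_mono[OF that(2), of "max k l"] by simp
  have "word_representable (lex_product G G') \<longleftrightarrow> (\<exists>k. k_word_representable k (lex_product G G'))"
    using fin by (simp add: word_representable_iff_k_word_representable)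
  then have "word_representable (lex_product G G') \<longleftrightarrow> word_representable G \<and> comparability_graph G'"
    unfolding G G' using up prod by blast
  moreover have "representation_number (lex_product G G') =
      max (representation_number G) (permutation_representation_number G')"
    if "word_representable G" "comparability_graph G'"
    unfolding representation_number_def[of "lex_product G G'"]
  proof (rule Least_equality)
    have "k_word_representable (representation_number G) G"
      using that(1) unfolding G representation_number_def by (rule LeastI_ex)
    moreover have "permutationally_k_representable (permutation_representation_number G') G'"
      using that(2) unfolding G' permutation_representation_number_def by (rule LeastI_ex)
    ultimately show "k_word_representable
        (max (representation_number G) (permutation_representation_number G')) (lex_product G G')"
      by (rule up)
  next
    fix k assume "k_word_representable k (lex_product G G')"
    then show "max (representation_number G) (permutation_representation_number G') \<le> k"
      unfolding prod representation_number_def permutation_representation_number_def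
      by (simp add: Least_le)
  qed
  ultimately show ?thesis by blast
qed

end
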